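(* For every positive integer $m$ and $q=6m$, there exists a code $C\subseteq B_q^4$ capable of correcting single deletions with $|C|=N(4,q,1)=\dfrac{q^2(q+2)}{4}$.
   Context: $B_q=\{0,\dots,q-1\}$ and $B_q^4$ is the set of words of length 4 over $B_q$. A code $C\subseteq B_q^4$ is capable of correcting single deletions if the sets $\lfloor x\rfloor_1$ ($x\in C$) of words obtained from $x$ by deleting one letter are pairwise disjoint (equivalently, the minimum deletion–insertion distance between distinct codewords exceeds 2). $N(4,q,1)$ is the maximum cardinality of such a code. *)

theory Defs
  imports Main
begin

definition words :: "nat \<Rightarrow> nat \<Rightarrow> nat list set" where
  "words n q = {x. length x = n \<and> set x \<subseteq> {0..<q}}"

definition del1 :: "nat list \<Rightarrow> nat list set" where
  "del1 x = {take i x @ drop (Suc i) x | i. i < length x}"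

definition single_deletion_code :: "nat list set \<Rightarrow> bool" where
  "single_deletion_code C \<longleftrightarrow>
     (\<forall>x\<in>C. \<forall>y\<in>C. x \<noteq> y \<longrightarrow> del1 x \<inter> del1 y = {})"

definition N1 :: "nat \<Rightarrow> nat \<Rightarrow> nat" where
  "N1 n q = Max {card C | C. C \<subseteq> words n q \<and> single_deletion_code C}"

end

theory Submission
  imports Defs
begin

text \<open>
  Upper bound: give the words $aaa$, $aab$ and $abb$, $aba$ and $abc$ the weights 4, 2, 1. The words
  obtained by one deletion from a word of length 4 have total weight at least 4, and the total weight
  of all words of length 3 is $q^3 + 2q^2 + q$. The excess $q$ is lost by parity: for every letter $a$
  there are $q - 1$ words $aba$, an odd number, so some word $aba$ is not obtained at all or some
  codeword yields an odd number of them, and then that codeword has surplus weight.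

  Construction: take all $xxyy$ together with words $abcd$ and $abca$ which cover each $xyz$ with
  $x \neq y \neq z$ exactly once, apart from $x\,\sigma(x)\,x$ for a fixed-point-free involution $\sigma$.
  Doubling the alphabet is easy, so let $q = 2M$ with $M = 3k$ odd and let the letters be
  $\mathbb{Z}_M \times \{0,1\}$. Three distinct residues lie in three parallelograms
  $p, p+u, p+v, p+u+v$ of $\mathbb{Z}_M$, one for each choice of the corner opposite to the fourth point. With
  $0 < u < v < M/2$ the vertices of a parallelogram can be told apart, and one fixed list of 16
  words per parallelogram does the covering. The degenerate parallelograms
  (arithmetic progressions) and the pairs of residues are treated alike; the cosets of the subgroup
  of order 3, where all three parallelograms degenerate, carry a copy of a code for $q = 6$.
\<close>

section \<open>Local covering tables\<close>

type_synonym 'a quad = "'a \<times> 'a \<times> 'a \<times> 'a"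
type_synonym 'a triple = "'a \<times> 'a \<times> 'a"

fun del4 :: "'a quad \<Rightarrow> 'a triple set" where
  "del4 (a, b, c, d) = {(b, c, d), (a, c, d), (a, b, d), (a, b, c)}"

definition covers :: "'a quad set \<Rightarrow> 'a triple \<Rightarrow> bool" where
  "covers K t \<longleftrightarrow> (\<exists>w\<in>K. t \<in> del4 w)"

text \<open>
  The following four tables come from a computer search for lists that are invariant under
  flipping all bits; \<^term>\<open>e\<close> runs through both bits. In \<open>block p x y z\<close> the letters are the vertices
  $p, p+u, p+v, p+u+v$ with $u < v$, in \<open>mids a c b\<close> the letter \<open>c\<close> is the midpoint of \<open>a\<close> and \<open>b\<close>.
\<close>

definition block :: "'i \<Rightarrow> 'i \<Rightarrow> 'i \<Rightarrow> 'i \<Rightarrow> bool \<Rightarrow> ('i \<times> bool) quad set" where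
  "block p x y z e =
    {((z, e), (p, \<not>e), (y, \<not>e), (x, \<not>e)), ((z, e), (x, e), (y, \<not>e), (p, e)),
     ((z, e), (x, \<not>e), (y, e), (p, e)), ((p, e), (z, \<not>e), (x, \<not>e), (y, \<not>e)),
     ((p, e), (y, e), (x, \<not>e), (z, e)), ((p, e), (y, \<not>e), (x, e), (z, e)),
     ((x, e), (y, e), (p, e), (z, \<not>e)), ((y, e), (x, e), (z, e), (p, \<not>e))}"

definition mids :: "'i \<Rightarrow> 'i \<Rightarrow> 'i \<Rightarrow> bool \<Rightarrow> ('i \<times> bool) quad set" where
  "mids a c b e =
    {((a, e), (c, e), (c, \<not>e), (b, e)), ((b, e), (c, e), (c, \<not>e), (a, e)),
     ((c, e), (a, e), (b, \<not>e), (c, \<not>e)), ((c, e), (b, e), (a, \<not>e), (c, \<not>e))}"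

definition pairs :: "'i \<Rightarrow> 'i \<Rightarrow> bool \<Rightarrow> ('i \<times> bool) quad set" where
  "pairs u v e =
    {((u, e), (v, \<not>e), (v, e), (u, e)), ((v, e), (u, \<not>e), (u, e), (v, e))}"

definition coset :: "'i \<Rightarrow> 'i \<Rightarrow> 'i \<Rightarrow> bool \<Rightarrow> ('i \<times> bool) quad set" where
  "coset i j l e =
    {((i, e), (i, \<not>e), (j, \<not>e), (l, e)), ((i, e), (j, \<not>e), (j, e), (i, e)),
     ((i, e), (j, \<not>e), (l, \<not>e), (i, \<not>e)), ((i, e), (l, e), (j, e), (i, \<not>e)),
     ((i, e), (l, e), (l, \<not>e), (i, e)), ((i, e), (l, \<not>e), (j, e), (j, \<not>e))}"

text \<open>These are 48 triples. Each of the 16 words of a block (both values of \<open>e\<close>)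
  serves every set of three vertices exactly once, so the three parallelograms contribute 16 triples
  each. A degenerate one contributes 16 through the 8 words of \<open>mids\<close>.\<close>

definition covers3 :: "('i \<times> bool) quad set \<Rightarrow> 'i \<Rightarrow> 'i \<Rightarrow> 'i \<Rightarrow> bool" where
  "covers3 K i j l \<longleftrightarrow> (\<forall>r s t.
     covers K ((i, r), (j, s), (l, t)) \<and> covers K ((i, r), (l, t), (j, s)) \<and>
     covers K ((j, s), (i, r), (l, t)) \<and> covers K ((j, s), (l, t), (i, r)) \<and>
     covers K ((l, t), (i, r), (j, s)) \<and> covers K ((l, t), (j, s), (i, r)))"

lemma covers_Un [simp]: "covers (A \<union> B) t \<longleftrightarrow> covers A t \<or> covers B t"
  by (auto simp: covers_def)

lemma covers_UN_bool [simp]: "covers (\<Union>e. F e) t \<longleftrightarrow> covers (F True) t \<or> covers (F False) t"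
  by (auto simp: covers_def UNIV_bool)

lemma covers_insert: "covers (insert w A) t \<longleftrightarrow> t \<in> del4 w \<or> covers A t" and
  covers_empty: "covers {} t \<longleftrightarrow> False"
  by (auto simp: covers_def)

lemmas table_simps = covers_insert covers_empty block_def mids_def pairs_def coset_def

text \<open>
  The auxiliary letters below are the fourth vertices of the parallelograms through three residues,
  whose differences, taken in the direction in which they are less than $M/2$, form either a
  transitive or a cyclic tournament.
\<close>

lemma transitive_less:
  "covers3 (\<Union>e. block s m t f e \<union> block f' s m t e \<union> block s m g t e) s m t"
  unfolding covers3_def all_bool_eq by (intro conjI; simp add: table_simps)

lemma transitive_greater:
  "covers3 (\<Union>e. block s m t f e \<union> block f' s m t e \<union> block s g m t e) s m t"
  unfolding covers3_def all_bool_eq by (intro conjI; simp add: table_simps)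

lemma transitive_equal:
  "covers3 (\<Union>e. block s m t f e \<union> block f' s m t e \<union> mids s m t e) s m t"
  unfolding covers3_def all_bool_eq by (intro conjI; simp add: table_simps)

text \<open>The names record two comparisons only: the cycle is rotated so that its first arc is
  shorter than its last, which fixes the place of \<open>f''\<close>.\<close>

lemma cyclic_less_less:
  "covers3 (\<Union>e. block i j f l e \<union> block j l f' i e \<union> block l f'' i j e) i j l"
  unfolding covers3_def all_bool_eq by (intro conjI; simp add: table_simps)

lemma cyclic_less_greater:
  "covers3 (\<Union>e. block i j f l e \<union> block j f' l i e \<union> block l f'' i j e) i j l"
  unfolding covers3_def all_bool_eq by (intro conjI; simp add: table_simps)

lemma cyclic_less_equal:
  "covers3 (\<Union>e. block i j f l e \<union> mids j l i e \<union> block l f'' i j e) i j l"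
  unfolding covers3_def all_bool_eq by (intro conjI; simp add: table_simps)

lemma cyclic_equal_less:
  "covers3 (\<Union>e. mids i j l e \<union> block j l f' i e \<union> block l f'' i j e) i j l"
  unfolding covers3_def all_bool_eq by (intro conjI; simp add: table_simps)

text \<open>These are 32 triples. Adjacent letters over the same residue need opposite bits to
  differ. The sandwich pattern has no such condition, because the omitted triples
  \<open>x, \<sigma> x, x\<close> lie over a single residue.\<close>

definition covers2 :: "('i \<times> bool) quad set \<Rightarrow> 'i \<Rightarrow> 'i \<Rightarrow> bool" where
  "covers2 K i j \<longleftrightarrow> (\<forall>r s t.
     (r \<noteq> t \<longrightarrow> covers K ((i, r), (i, t), (j, s))) \<and> covers K ((i, r), (j, s), (i, t)) \<and>
     (r \<noteq> t \<longrightarrow> covers K ((j, s), (i, r), (i, t))) \<and>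
     (r \<noteq> t \<longrightarrow> covers K ((j, r), (j, t), (i, s))) \<and> covers K ((j, r), (i, s), (j, t)) \<and>
     (r \<noteq> t \<longrightarrow> covers K ((i, s), (j, r), (j, t))))"

text \<open>The pair is the first step of one progression and the last step of another. Each of the
  two \<open>mids\<close> tables supplies 8 of the 32 triples, and \<open>pairs\<close> the other
  16.\<close>

lemma pairs_cover:
  "covers2 (\<Union>e. pairs u v e \<union> mids u v w e \<union> mids w' u v e) u v"
  unfolding covers2_def all_bool_eq by (intro conjI; simp add: table_simps)

text \<open>The 36 words have 144 deletions, which is 48 for the three residues plus 32 for each of
  the three pairs. Rotating the coset gives the other two pairs.\<close>

lemma coset_cover:
  fixes i j l defines "K \<equiv> (\<Union>e. coset i j l e \<union> coset j l i e \<union> coset l i j e)"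
  shows "covers3 K i j l" "covers2 K i j"
  unfolding K_def covers2_def covers3_def all_bool_eq by (intro conjI; simp add: table_simps)+

section \<open>Alphabets of size $6k$ with $k$ odd\<close>

definition targets :: "('a \<Rightarrow> 'a) \<Rightarrow> 'a set \<Rightarrow> 'a triple set" where
  "targets \<sigma> X = {(x, y, z). x \<in> X \<and> y \<in> X \<and> z \<in> X \<and> x \<noteq> y \<and> y \<noteq> z \<and> \<not> (x = z \<and> y = \<sigma> x)}"

text \<open>
  By the cardinality condition, covering all targets at least once means covering them exactly once.
\<close>

definition core :: "'a set \<Rightarrow> ('a \<Rightarrow> 'a) \<Rightarrow> 'a quad set \<Rightarrow> bool" where
  "core X \<sigma> K \<longleftrightarrow> finite X \<and> K \<subseteq> X \<times> X \<times> X \<times> X \<and>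
     (\<forall>x\<in>X. \<sigma> x \<in> X \<and> \<sigma> x \<noteq> x \<and> \<sigma> (\<sigma> x) = x) \<and>
     (\<forall>t\<in>targets \<sigma> X. covers K t) \<and> 4 * card K + card X \<le> card X * (card X - 1)\<^sup>2"

lemma covers_mono: "covers K t \<Longrightarrow> K \<subseteq> L \<Longrightarrow> covers L t"
  by (auto simp: covers_def)

lemma covers3_mono:
  assumes "covers3 K i j l" "K \<subseteq> L" shows "covers3 L i j l"
  using assms(1) covers_mono[OF _ assms(2)] unfolding covers3_def by simp

lemma covers2_mono:
  assumes "covers2 K i j" "K \<subseteq> L" shows "covers2 L i j"
  using assms(1) covers_mono[OF _ assms(2)] unfolding covers2_def by simp

lemma covers3_perm:
  assumes "covers3 K i j l"
  shows "covers3 K i l j" "covers3 K j i l" "covers3 K j l i" "covers3 K l i j" "covers3 K l j i"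
  using assms unfolding covers3_def by simp_all

lemma covers2_swap: "covers2 K i j \<Longrightarrow> covers2 K j i"
  unfolding covers2_def by simp

lemma UN_Un3_subset:
  "(\<Union>e. A e) \<subseteq> K \<Longrightarrow> (\<Union>e. B e) \<subseteq> K \<Longrightarrow> (\<Union>e. C e) \<subseteq> K \<Longrightarrow>
    (\<Union>e. A e \<union> B e \<union> C e) \<subseteq> K"
  by blast

lemma card_insert_Suc: "card A \<le> n \<Longrightarrow> card (insert x A) \<le> Suc n"
  by (cases "finite A") (auto simp: card_insert_if)

lemma card_tables:
  "card (block p x y z e) \<le> 8" "card (mids a c b e) \<le> 4" "card (pairs u v e) \<le> 2" "card (coset i j l e) \<le> 6"
  unfolding block_def mids_def pairs_def coset_def
  by (rule order_trans, (rule card_insert_Suc)+, rule card.empty[THEN eq_imp_le], simp)+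

lemma tables_range:
  fixes I :: "'i set" defines "Q \<equiv> (I \<times> UNIV) \<times> (I \<times> UNIV) \<times> (I \<times> UNIV) \<times> (I \<times> UNIV)"
  shows "block p x y z e \<subseteq> Q \<longleftrightarrow> p \<in> I \<and> x \<in> I \<and> y \<in> I \<and> z \<in> I"
    "mids a c b e \<subseteq> Q \<longleftrightarrow> a \<in> I \<and> c \<in> I \<and> b \<in> I"
    "pairs u v e \<subseteq> Q \<longleftrightarrow> u \<in> I \<and> v \<in> I"
    "coset i j l e \<subseteq> Q \<longleftrightarrow> i \<in> I \<and> j \<in> I \<and> l \<in> I"
  unfolding Q_def block_def mids_def pairs_def coset_def by (simp_all, blast+)

lemma card_UN_bounded:
  assumes "finite A" "\<And>x. x \<in> A \<Longrightarrow> card (F x) \<le> c"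
  shows "card (\<Union>x\<in>A. F x) \<le> card A * c"
proof -
  have "card (\<Union>x\<in>A. F x) \<le> (\<Sum>x\<in>A. card (F x))" by (rule card_UN_le[OF assms(1)])
  also have "\<dots> \<le> card A * c" using sum_bounded_above[of A "\<lambda>x. card (F x)" c] assms(2) by simp
  finally show ?thesis .
qed

locale odd_base =
  fixes h :: nat and k M :: int
  assumes M_h: "M = 2 * int h + 1" and M_k: "M = 3 * k"
begin

text \<open>Every pair of residues is oriented along the shorter way round, which is unique since
  \<open>M\<close> is odd. Divisibility is used in place of \<open>mod\<close> so that congruences
  can be added.\<close>

definition arc :: "int \<Rightarrow> int \<Rightarrow> int \<Rightarrow> bool" where
  "arc a b d \<longleftrightarrow> a \<in> {0..<M} \<and> b \<in> {0..<M} \<and> d \<in> {1..int h} \<and> M dvd a + d - b"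

text \<open>Choosing the signs of the two steps makes both at most \<open>h\<close>, and
  \<open>u < v\<close> orders them.\<close>

definition blocks :: "(int \<times> bool) quad set" where
  "blocks = (\<Union>(p, v, u) \<in> {0..<M} \<times> (SIGMA v:{1..int h}. {1..<v}).
     \<Union>e. block p ((p + u) mod M) ((p + v) mod M) ((p + u + v) mod M) e)"

text \<open>These are the parallelograms with \<open>u = v\<close>. The step \<open>k\<close> is
  left out, as it leads to a coset of the subgroup of order 3.\<close>

definition progressions :: "(int \<times> bool) quad set" where
  "progressions = (\<Union>(a, u) \<in> {0..<M} \<times> ({1..int h} - {k}).
     \<Union>e. mids a ((a + u) mod M) ((a + 2 * u) mod M) e \<union> pairs a ((a + u) mod M) e)"

text \<open>Since \<open>i\<close> runs through all residues, each coset occurs in its three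
  rotations.\<close>

definition cosets :: "(int \<times> bool) quad set" where
  "cosets = (\<Union>i\<in>{0..<M}. \<Union>e. coset i ((i + k) mod M) ((i + 2 * k) mod M) e)"

definition base_core :: "(int \<times> bool) quad set" where
  "base_core = blocks \<union> progressions \<union> cosets"

lemma M_pos: "0 < M" and k_pos: "0 < k" and k_le: "k \<le> int h"
  using M_h M_k by linarith+

lemma mod_range: "a mod M \<in> {0..<M}"
  using M_pos by simp

lemma dvd_mod: "M dvd a - a mod M" "M dvd a mod M - a"
  by (metis dvd_minus_mod, metis dvd_minus_iff dvd_minus_mod minus_diff_eq)

lemma mod_eqI: "b \<in> {0..<M} \<Longrightarrow> M dvd a - b \<Longrightarrow> a mod M = b"
  by (metis mod_eq_dvd_iff mod_pos_pos_trivial atLeastLessThan_iff)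

lemma dvd_sumI:
  assumes "M dvd (a::int)" "M dvd b" "c = a + b \<or> c = a - b" shows "M dvd c"
  using assms by auto

section \<open>Parallelograms and progressions through given arcs\<close>

lemma blockI:
  assumes "p \<in> {0..<M}" "x \<in> {0..<M}" "y \<in> {0..<M}" "z \<in> {0..<M}" "1 \<le> u" "u < v" "v \<le> int h"
    "M dvd p + u - x" "M dvd p + v - y" "M dvd p + u + v - z"
  shows "(\<Union>e. block p x y z e) \<subseteq> base_core"
proof -
  have eq: "x = (p + u) mod M" "y = (p + v) mod M" "z = (p + u + v) mod M"
    using assms mod_eqI by metis+
  have "(p, v, u) \<in> {0..<M} \<times> (SIGMA v:{1..int h}. {1..<v})" using assms by auto
  then have "(\<Union>e. block p x y z e) \<subseteq> blocks" unfolding blocks_def eq by blast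
  then show ?thesis by (auto simp: base_core_def)
qed

text \<open>The fourth vertex lies opposite to \<open>s\<close>; \<open>u < w\<close> puts
  \<open>m\<close> into the place of the shorter step.\<close>

lemma source_block:
  assumes "arc s m u" "arc s t w" "u < w"
  shows "(\<Union>e. block s m t ((s + u + w) mod M) e) \<subseteq> base_core"
  by (rule blockI[of _ _ _ _ u w]) (use assms mod_range dvd_mod in \<open>auto simp: arc_def\<close>)

lemma sink_block:
  assumes "arc m t v" "arc s t w" "v < w"
  shows "(\<Union>e. block ((t - v - w) mod M) s m t e) \<subseteq> base_core"
proof (rule blockI[of _ _ _ _ v w])
  have d: "M dvd m + v - t" "M dvd s + w - t" "M dvd (t - v - w) mod M - (t - v - w)"
    using assms dvd_mod by (auto simp: arc_def)
  show "M dvd (t - v - w) mod M + v - s" using d(3,2) by (rule dvd_sumI) simp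
  show "M dvd (t - v - w) mod M + w - m" using d(3,1) by (rule dvd_sumI) simp
  show "M dvd (t - v - w) mod M + v + w - t" using d(3) by (simp add: algebra_simps)
qed (use assms mod_range in \<open>auto simp: arc_def\<close>)

text \<open>The fourth vertex lies opposite to the middle residue \<open>j\<close>. The smaller of
  \<open>a\<close> and \<open>b\<close> decides whether \<open>j\<close> or the new vertex takes the
  place of the shorter step.\<close>

lemma mid_block_less:
  assumes "arc i j a" "arc j l b" "a < b"
  shows "(\<Union>e. block i j ((i + b) mod M) l e) \<subseteq> base_core"
proof (rule blockI[of _ _ _ _ a b])
  have d: "M dvd i + a - j" "M dvd j + b - l" using assms by (auto simp: arc_def)
  then show "M dvd i + a + b - l" by (rule dvd_sumI) simp
qed (use assms mod_range dvd_mod in \<open>auto simp: arc_def\<close>)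

lemma mid_block_greater:
  assumes "arc i j a" "arc j l b" "b < a"
  shows "(\<Union>e. block i ((i + b) mod M) j l e) \<subseteq> base_core"
proof (rule blockI[of _ _ _ _ b a])
  have d: "M dvd i + a - j" "M dvd j + b - l" using assms by (auto simp: arc_def)
  then show "M dvd i + b + a - l" by (rule dvd_sumI) simp
qed (use assms mod_range dvd_mod in \<open>auto simp: arc_def\<close>)

lemma progressionI:
  assumes "arc i j a" "arc j l a" "a \<noteq> k"
  shows "(\<Union>e. mids i j l e \<union> pairs i j e) \<subseteq> base_core"
proof -
  have d: "M dvd i + a - j" "M dvd j + a - l" using assms by (auto simp: arc_def)
  then have "M dvd i + 2 * a - l" by (rule dvd_sumI) simp
  then have eq: "j = (i + a) mod M" "l = (i + 2 * a) mod M"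
    using d assms mod_eqI unfolding arc_def by metis+
  have "(i, a) \<in> {0..<M} \<times> ({1..int h} - {k})" using assms by (auto simp: arc_def)
  then have "(\<Union>e. mids i j l e \<union> pairs i j e) \<subseteq> progressions" unfolding progressions_def eq by blast
  then show ?thesis by (auto simp: base_core_def)
qed

lemma mid_equal:
  assumes "arc i j a" "arc j l a" "a \<noteq> k"
  shows "(\<Union>e. mids i j l e) \<subseteq> base_core"
  using progressionI[OF assms] by blast

lemma arc_next: "a \<in> {0..<M} \<Longrightarrow> d \<in> {1..int h} \<Longrightarrow> arc a ((a + d) mod M) d"
  using mod_range dvd_mod by (auto simp: arc_def)

lemma arc_prev: "b \<in> {0..<M} \<Longrightarrow> d \<in> {1..int h} \<Longrightarrow> arc ((b - d) mod M) b d"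
  using mod_range[of "b - d"] dvd_mod(2)[of "b - d"] by (auto simp: arc_def algebra_simps)

lemma arc_bounds: "arc a b d \<Longrightarrow> 1 \<le> d \<and> 2 * d < M"
  unfolding arc_def using M_h by simp

lemma arc_total:
  assumes "a \<in> {0..<M}" "b \<in> {0..<M}" "a \<noteq> b"
  shows "\<exists>d. arc a b d \<or> arc b a d"
proof -
  define d where "d = (b - a) mod M"
  have r: "d \<in> {0..<M}" unfolding d_def by (rule mod_range)
  have dv: "M dvd d - (b - a)" unfolding d_def by (rule dvd_mod)
  have "d \<noteq> 0"
  proof
    assume "d = 0"
    then have "M dvd b - a" by (auto simp: d_def)
    then have "b mod M = a" using assms mod_eqI by blast
    then show False using assms by simp
  qed
  then have "1 \<le> d" using r by simp
  show ?thesis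
  proof (cases "d \<le> int h")
    case True
    then have "arc a b d" using \<open>1 \<le> d\<close> assms dv by (auto simp: arc_def algebra_simps)
    then show ?thesis by blast
  next
    case False
    \<comment> \<open>As \<open>M = 2 * h + 1\<close>, a distance above \<open>h\<close> in one
      direction is at most \<open>h\<close> in the other.\<close>
    then have "M - d \<in> {1..int h}" using r M_h by simp
    moreover have "M dvd b + (M - d) - a" using dvd_refl dv by (rule dvd_sumI) simp
    ultimately have "arc b a (M - d)" using assms unfolding arc_def by blast
    then show ?thesis by blast
  qed
qed

lemma dvd_bounded:
  assumes "M dvd c" "0 < c" "c < 2 * M" shows "c = M"
proof -
  obtain q where q: "c = M * q" using assms by blast
  then have "0 < q" "q < 2" using assms M_pos by (simp_all add: zero_less_mult_iff mult.commute)
  then show ?thesis using q by simp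
qed

lemma dvd_small:
  assumes "M dvd c" "\<bar>c\<bar> < M" shows "c = 0"
  using assms zdvd_imp_le[of M "\<bar>c\<bar>"] by auto

lemma transitive_cover:
  assumes "arc s m u" "arc m t v" "arc s t w"
  shows "covers3 base_core s m t"
proof -
  have d: "M dvd s + u - m" "M dvd m + v - t" "M dvd s + w - t" using assms by (auto simp: arc_def)
  have "M dvd s + u + v - t" using d(1,2) by (rule dvd_sumI) simp
  then have "M dvd u + v - w" using d(3) by (rule dvd_sumI) simp
  \<comment> \<open>All three distances are below \<open>M / 2\<close>, so this multiple of
    \<open>M\<close> has absolute value below \<open>M\<close>.\<close>
  then have w: "w = u + v" using dvd_small[of "u + v - w"] assms[THEN arc_bounds] by linarith
  then have lt: "u < w" "v < w" using assms by (auto simp: arc_def)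
  note S = source_block[OF assms(1,3) lt(1)] and T = sink_block[OF assms(2,3) lt(2)]
  consider "u < v" | "v < u" | "u = v" by linarith
  then show ?thesis
  proof cases
    case 1
    show ?thesis
      by (rule covers3_mono[OF transitive_less UN_Un3_subset[OF S T mid_block_less[OF assms(1,2) 1]]])
  next
    case 2
    show ?thesis
      by (rule covers3_mono[OF transitive_greater UN_Un3_subset[OF S T mid_block_greater[OF assms(1,2) 2]]])
  next
    case 3
    \<comment> \<open>With \<open>u = v = k\<close> the arc \<open>w\<close> would be
      \<open>2 * k\<close>, which exceeds \<open>M / 2\<close>.\<close>
    then have "u \<noteq> k" using w arc_bounds[OF assms(3)] M_k by linarith
    then have "(\<Union>e. mids s m t e) \<subseteq> base_core" using mid_equal assms(1,2) 3 by simp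
    then show ?thesis by (rule covers3_mono[OF transitive_equal UN_Un3_subset[OF S T]])
  qed
qed

lemma coset_subset:
  assumes "arc i j k" "arc j l k"
  shows "(\<Union>e. coset i j l e \<union> coset j l i e \<union> coset l i j e) \<subseteq> base_core"
proof -
  have d: "M dvd i + k - j" "M dvd j + k - l" using assms by (auto simp: arc_def)
  have l: "M dvd i + 2 * k - l" using d by (rule dvd_sumI) simp
  \<comment> \<open>The progression with step \<open>k\<close> closes up because
    \<open>3 * k = M\<close>.\<close>
  have i: "M dvd j + 2 * k - i" using dvd_sumI[OF dvd_refl d(1)] M_k by simp
  have i': "M dvd l + k - i" using dvd_sumI[OF i d(2)] by simp
  have j: "M dvd l + 2 * k - j" using i' d(1) by (rule dvd_sumI) simp
  have *: "(\<Union>e. coset a b c e) \<subseteq> base_core"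
    if "a \<in> {0..<M}" "b \<in> {0..<M}" "c \<in> {0..<M}" "M dvd a + k - b" "M dvd a + 2 * k - c" for a b c
  proof -
    have "b = (a + k) mod M" "c = (a + 2 * k) mod M" using that mod_eqI by metis+
    then show ?thesis using that(1) unfolding base_core_def cosets_def by blast
  qed
  have r: "i \<in> {0..<M}" "j \<in> {0..<M}" "l \<in> {0..<M}" using assms by (auto simp: arc_def)
  show ?thesis using r d l i i' j by (intro UN_Un3_subset *)
qed

text \<open>The hypotheses put a shortest arc first and, if exactly two arcs are shortest, both of
  them in front. This leaves five comparison patterns, one for each cyclic table and one for the
  coset.\<close>

lemma cyclic_cover_min:
  assumes "arc i j a" "arc j l b" "arc l i c" "a \<le> b" "a < c \<or> a = b \<and> a = c"
  shows "covers3 base_core i j l"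
proof -
  have d: "M dvd i + a - j" "M dvd j + b - l" "M dvd l + c - i" using assms by (auto simp: arc_def)
  have "M dvd i + a + b - l" using d(1,2) by (rule dvd_sumI) simp
  then have "M dvd a + b + c" using d(3) by (rule dvd_sumI) simp
  \<comment> \<open>The sum is positive and below \<open>3 * M / 2\<close>.\<close>
  then have sum: "a + b + c = M" using dvd_bounded[of "a + b + c"] assms(1-3)[THEN arc_bounds] by linarith
  consider "a = b" "a = c" | "a < b" "b < c" | "a < b" "c < b" "a < c" | "a < b" "b = c" | "a = b" "a < c"
    using assms(4,5) by linarith
  then show ?thesis
  proof cases
    case 1
    then have "a = k" using sum M_k by simp
    then show ?thesis using covers3_mono[OF coset_cover(1) coset_subset] assms(1,2) 1 by simp
  next
    case 2
    then have "a < c" by simp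
    show ?thesis
      by (rule covers3_mono[OF cyclic_less_less UN_Un3_subset[OF mid_block_less[OF assms(1,2) 2(1)]
        mid_block_less[OF assms(2,3) 2(2)] mid_block_greater[OF assms(3,1) \<open>a < c\<close>]]])
  next
    case 3
    show ?thesis
      by (rule covers3_mono[OF cyclic_less_greater UN_Un3_subset[OF mid_block_less[OF assms(1,2) 3(1)]
        mid_block_greater[OF assms(2,3) 3(2)] mid_block_greater[OF assms(3,1) 3(3)]]])
  next
    case 4
    then have "b \<noteq> k" "a < c" using sum M_k by auto
    then have "(\<Union>e. mids j l i e) \<subseteq> base_core" using mid_equal assms(2,3) 4(2) by simp
    then show ?thesis
      by (rule covers3_mono[OF cyclic_less_equal UN_Un3_subset[OF mid_block_less[OF assms(1,2) 4(1)]
        _ mid_block_greater[OF assms(3,1) \<open>a < c\<close>]]])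
  next
    case 5
    then have "a \<noteq> k" "b < c" using sum M_k by auto
    then have "(\<Union>e. mids i j l e) \<subseteq> base_core" using mid_equal assms(1,2) 5(1) by simp
    then show ?thesis
      by (rule covers3_mono[OF cyclic_equal_less UN_Un3_subset[OF
        _ mid_block_less[OF assms(2,3) \<open>b < c\<close>] mid_block_greater[OF assms(3,1) 5(2)]]])
  qed
qed

lemma cyclic_cover:
  assumes "arc i j a" "arc j l b" "arc l i c"
  shows "covers3 base_core i j l"
proof -
  consider "a \<le> b" "a < c \<or> a = b \<and> a = c" | "b \<le> c" "b < a \<or> b = c \<and> b = a" | "c \<le> a" "c < b \<or> c = a \<and> c = b"
    by linarith
  then show ?thesis
  proof cases
    case 1
    then show ?thesis by (rule cyclic_cover_min[OF assms])
  next
    case 2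
    then show ?thesis by (rule covers3_perm(4)[OF cyclic_cover_min[OF assms(2,3,1)]])
  next
    case 3
    then show ?thesis by (rule covers3_perm(3)[OF cyclic_cover_min[OF assms(3,1,2)]])
  qed
qed

text \<open>A tournament on three vertices is transitive or cyclic, and \<open>covers3\<close> is
  symmetric in the residues.\<close>

lemma triple_cover:
  assumes "i \<in> {0..<M}" "j \<in> {0..<M}" "l \<in> {0..<M}" "i \<noteq> j" "j \<noteq> l" "i \<noteq> l"
  shows "covers3 base_core i j l"
proof -
  obtain a b c where "arc i j a \<or> arc j i a" "arc j l b \<or> arc l j b" "arc i l c \<or> arc l i c"
    using arc_total assms by metis
  then have "covers3 base_core i j l \<or> covers3 base_core i l j \<or> covers3 base_core j i l \<or>
      covers3 base_core j l i \<or> covers3 base_core l i j \<or> covers3 base_core l j i"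
    by (elim disjE) (blast dest: transitive_cover cyclic_cover)+
  then show ?thesis using covers3_perm by metis
qed

text \<open>The arc is prolonged by its own length at both ends, giving the two progressions of
  \<open>pairs_cover\<close>; for length \<open>k\<close> it lies in a coset.\<close>

lemma pair_cover:
  assumes "arc u v d" shows "covers2 base_core u v"
proof (cases "d = k")
  case True
  have "arc v ((v + d) mod M) d" using assms by (intro arc_next) (auto simp: arc_def)
  then show ?thesis using covers2_mono[OF coset_cover(2) coset_subset] assms by (simp add: True)
next
  case False
  define w w' where "w = (v + d) mod M" and "w' = (u - d) mod M"
  have "arc v w d" "arc w' u d"
    unfolding w_def w'_def using arc_next[of v d] arc_prev[of u d] assms by (simp_all add: arc_def)
  then have "(\<Union>e. mids u v w e \<union> pairs u v e) \<subseteq> base_core" "(\<Union>e. mids w' u v e \<union> pairs w' u e) \<subseteq> base_core"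
    using progressionI assms False by blast+
  then have "(\<Union>e. pairs u v e \<union> mids u v w e \<union> mids w' u v e) \<subseteq> base_core" by blast
  then show ?thesis by (rule covers2_mono[OF pairs_cover])
qed


section \<open>Counting the words of the odd construction\<close>

lemma card_blocks: "card blocks \<le> 8 * nat M * (h * (h - 1))"
proof -
  let ?T = "SIGMA v:{1..int h}. {1..<v}"
  have c8: "card (\<Union>e. block p x y z e) \<le> 16" for p x y z :: int
    using card_UN_bounded[of UNIV "block p x y z" 8] by (simp add: card_tables)
  \<comment> \<open>The number of pairs \<open>u < v\<close> is doubled to avoid a division.\<close>
  have "(\<Sum>v\<in>{1..int h}. nat (v - 1)) * 2 = h * (h - 1)"
  proof (induction h)
    case (Suc n)
    have "{1..int (Suc n)} = insert (int (Suc n)) {1..int n}" by auto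
    then show ?case using Suc by (cases n) (auto simp: algebra_simps)
  qed simp
  then have T: "card ?T * 2 = h * (h - 1)" by simp
  have "card blocks \<le> card ({0..<M} \<times> ?T) * 16"
    unfolding blocks_def by (rule card_UN_bounded) (use c8 in \<open>auto split: prod.split\<close>)
  also have "\<dots> = 8 * nat M * (card ?T * 2)" by (simp add: card_cartesian_product)
  finally show ?thesis unfolding T .
qed

lemma card_progressions: "card progressions \<le> 12 * nat M * (h - 1)"
proof -
  have c: "card (\<Union>e. mids a c b e \<union> pairs a c e) \<le> 12" for a b c :: int
  proof -
    have "card (mids a c b e \<union> pairs a c e) \<le> 6" for e
      using card_Un_le[of "mids a c b e" "pairs a c e"] card_tables(2)[of a c b e] card_tables(3)[of a c e] by linarith
    then show ?thesis using card_UN_bounded[of UNIV "\<lambda>e. mids a c b e \<union> pairs a c e" 6] by simp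
  qed
  have "card ({1..int h} - {k}) = h - 1" using k_pos k_le by simp
  moreover have "card progressions \<le> card ({0..<M} \<times> ({1..int h} - {k})) * 12"
    unfolding progressions_def by (rule card_UN_bounded) (use c in \<open>auto split: prod.split\<close>)
  ultimately show ?thesis by (simp add: card_cartesian_product mult_ac)
qed

lemma card_cosets: "card cosets \<le> 12 * nat M"
proof -
  have "card (\<Union>e. coset i j l e) \<le> 12" for i j l :: int
    using card_UN_bounded[of UNIV "coset i j l" 6] by (simp add: card_tables)
  then show ?thesis
    using card_UN_bounded[of "{0..<M}" "\<lambda>i. \<Union>e. coset i ((i + k) mod M) ((i + 2 * k) mod M) e" 12]
    unfolding cosets_def by simp
qed

theorem core_base_core: "core ({0..<M} \<times> UNIV) (\<lambda>(i, b). (i, \<not> b)) base_core"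
proof -
  let ?X = "{0..<M} \<times> (UNIV :: bool set)" and ?\<sigma> = "\<lambda>(i :: int, b). (i, \<not> b)"
  have "covers base_core ((i, r), (j, s), (l, t))"
    if t: "((i, r), (j, s), (l, t)) \<in> targets ?\<sigma> ?X" for i j l r s t
  proof -
    have r: "i \<in> {0..<M}" "j \<in> {0..<M}" "l \<in> {0..<M}" using t by (auto simp: targets_def)
    have P: "covers2 base_core a b" if "a \<in> {0..<M}" "b \<in> {0..<M}" "a \<noteq> b" for a b
      using arc_total[OF that] by (auto dest: pair_cover intro: covers2_swap[OF pair_cover])
    \<comment> \<open>In the last case all letters lie over one residue, and only the excluded
      triples \<open>x, \<sigma> x, x\<close> have distinct neighbours there.\<close>
    consider "i \<noteq> j" "j \<noteq> l" "i \<noteq> l" | "i \<noteq> j" "i = l" | "i = j" "j \<noteq> l" | "i \<noteq> j" "j = l" | "i = j" "j = l"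
      by blast
    then show ?thesis
    proof cases
      case 1
      then show ?thesis using triple_cover[OF r 1(1,2,3)] by (simp add: covers3_def)
    next
      case 2
      then show ?thesis using P[OF r(1,2)] by (simp add: covers2_def)
    next
      case 3
      then show ?thesis using P[OF r(1,3)] t by (simp add: covers2_def targets_def)
    next
      case 4
      then show ?thesis using P[OF r(1,2)] t by (simp add: covers2_def targets_def)
    next
      case 5
      then show ?thesis using t by (auto simp: targets_def)
    qed
  qed
  then have cov: "\<forall>t\<in>targets ?\<sigma> ?X. covers base_core t" by auto
  let ?Q = "?X \<times> ?X \<times> ?X \<times> ?X"
  have in_range: "block p (a mod M) (b mod M) (c mod M) e \<subseteq> ?Q" "mids p (a mod M) (b mod M) e \<subseteq> ?Q"
    "pairs p (a mod M) e \<subseteq> ?Q" "coset p (a mod M) (b mod M) e \<subseteq> ?Q" if "p \<in> {0..<M}" for p a b c e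
    using that mod_range by (simp_all only: tables_range)
  have "blocks \<subseteq> ?Q" unfolding blocks_def
    by (intro UN_least) (simp only: mem_Sigma_iff split: prod.split, use in_range in blast)
  moreover have "progressions \<subseteq> ?Q" unfolding progressions_def
    by (intro UN_least) (simp only: mem_Sigma_iff split: prod.split, use in_range in blast)
  moreover have "cosets \<subseteq> ?Q" unfolding cosets_def
    using in_range by (intro UN_least) blast
  ultimately have sub: "base_core \<subseteq> ?Q"
    by (simp add: base_core_def)
  have cX: "card ?X = 2 * nat M" by (simp add: card_cartesian_product)
  have nM: "nat M = 2 * h + 1" using M_h by simp
  have "1 \<le> h" using k_pos k_le by simp
  then obtain g where g: "h = Suc g" by (cases h) auto
  have "card base_core \<le> card blocks + card progressions + card cosets"
    unfolding base_core_def using card_Un_le le_trans add_le_mono1 by meson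
  then have "card base_core \<le> 8 * nat M * (h * (h - 1)) + 12 * nat M * (h - 1) + 12 * nat M"
    using card_blocks card_progressions card_cosets by linarith
  \<comment> \<open>The bound equals \<open>4 * M^2 * h\<close>, and
    \<open>16 * M^2 * h + 2 * M = 2 * M * (2 * M - 1)^2\<close> because
    \<open>2 * h = M - 1\<close>.\<close>
  then have "4 * card base_core + card ?X \<le> card ?X * (card ?X - 1)\<^sup>2"
    unfolding cX nM by (simp add: g power2_eq_square algebra_simps)
  then show ?thesis using cov sub by (auto simp: core_def)
qed

end

section \<open>Doubling the alphabet\<close>

text \<open>The fourth bit is the exclusive or of the others, so any three bits determine the
  remaining one, whichever letter is deleted.\<close>

definition lifts :: "'a quad set \<Rightarrow> ('a \<times> bool) quad set" where
  "lifts K = (\<Union>((a, b, c, d), r, s, t) \<in> K \<times> UNIV. {((a, r), (b, s), (c, t), (d, r \<noteq> (s \<noteq> t)))})"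

text \<open>These words serve the triples over \<open>a, a, b\<close> and \<open>a, b, b\<close>,
  which are no targets over \<open>X\<close>. The pairs \<open>a, \<sigma> a\<close> are left to
  \<open>quads\<close>.\<close>

definition squares :: "'a set \<Rightarrow> ('a \<Rightarrow> 'a) \<Rightarrow> ('a \<times> bool) quad set" where
  "squares X \<sigma> = (\<Union>(a, b) \<in> (SIGMA a:X. X - {a, \<sigma> a}). \<Union>r. {((a, r), (a, \<not> r), (b, r), (b, \<not> r))})"

text \<open>Both orders of a pair \<open>a, \<sigma> a\<close> together give 8 words for its 32
  triples, including those over the sandwiches \<open>a, \<sigma> a, a\<close> omitted from the
  targets over \<open>X\<close>.\<close>

definition quads :: "'a \<Rightarrow> 'a \<Rightarrow> ('a \<times> bool) quad set" where
  "quads a b =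
    {((a, False), (b, False), (b, True), (a, False)), ((a, False), (b, True), (b, False), (a, True)),
     ((a, True), (b, False), (b, True), (a, True)), ((a, True), (b, True), (a, False), (b, False))}"

definition double :: "'a set \<Rightarrow> ('a \<Rightarrow> 'a) \<Rightarrow> 'a quad set \<Rightarrow> ('a \<times> bool) quad set" where
  "double X \<sigma> K = lifts K \<union> squares X \<sigma> \<union> (\<Union>a\<in>X. quads a (\<sigma> a))"

lemma quads_cover: "covers2 (quads a b \<union> quads b a) a b"
  unfolding covers2_def all_bool_eq by (intro conjI; simp add: covers_insert covers_empty quads_def)

lemma lifts_cover:
  assumes "covers K (x, y, z)" shows "covers (lifts K) ((x, r), (y, s), (z, t))"
proof -
  obtain a b c d where w: "(a, b, c, d) \<in> K" and t: "(x, y, z) \<in> del4 (a, b, c, d)"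
    using assms by (auto simp: covers_def)
  have L: "((a, r), (b, s), (c, t), (d, r \<noteq> (s \<noteq> t))) \<in> lifts K" for r s t
    unfolding lifts_def by (rule UN_I[of "((a, b, c, d), r, s, t)"]) (use w in simp_all)
  \<comment> \<open>Each identity recovers the last bit when the bit of a deleted earlier letter is
    chosen as the exclusive or.\<close>
  have x: "(r \<noteq> (s \<noteq> (r \<noteq> (s \<noteq> t)))) = t" "(r \<noteq> ((r \<noteq> (s \<noteq> t)) \<noteq> s)) = t"
     "((r \<noteq> (s \<noteq> t)) \<noteq> (r \<noteq> s)) = t" by auto
  show ?thesis using t L[of "r \<noteq> (s \<noteq> t)" r s] L[of r "r \<noteq> (s \<noteq> t)" s] L[of r s "r \<noteq> (s \<noteq> t)"] L[of r s t]
    unfolding covers_def x by (auto intro: rev_bexI)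
qed

lemma squares_cover:
  assumes "a \<in> X" "b \<in> X" "b \<noteq> a" "b \<noteq> \<sigma> a"
  shows "r \<noteq> s \<Longrightarrow> covers (squares X \<sigma>) ((a, r), (a, s), (b, t))"
    "s \<noteq> t \<Longrightarrow> covers (squares X \<sigma>) ((a, r), (b, s), (b, t))"
proof -
  have S: "((a, r), (a, \<not> r), (b, r), (b, \<not> r)) \<in> squares X \<sigma>" for r
    using assms by (force simp: squares_def)
  show "r \<noteq> s \<Longrightarrow> covers (squares X \<sigma>) ((a, r), (a, s), (b, t))"
    unfolding covers_def using S[of r] by (intro bexI[OF _ S[of r]]) auto
  show "s \<noteq> t \<Longrightarrow> covers (squares X \<sigma>) ((a, r), (b, s), (b, t))"
    unfolding covers_def by (intro bexI[OF _ S[of s]]) auto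
qed

theorem core_double:
  assumes "core X \<sigma> K"
  shows "core (X \<times> UNIV) (\<lambda>(x, b). (x, \<not> b)) (double X \<sigma> K)"
proof -
  let ?D = "double X \<sigma> K" and ?Y = "X \<times> (UNIV :: bool set)" and ?\<tau> = "\<lambda>(x :: 'a, b). (x, \<not> b)"
  have fin: "finite X" and K: "K \<subseteq> X \<times> X \<times> X \<times> X"
    and \<sigma>: "\<And>x. x \<in> X \<Longrightarrow> \<sigma> x \<in> X \<and> \<sigma> x \<noteq> x \<and> \<sigma> (\<sigma> x) = x"
    and cov: "\<And>t. t \<in> targets \<sigma> X \<Longrightarrow> covers K t"
    and card: "4 * card K + card X \<le> card X * (card X - 1)\<^sup>2"
    using assms by (auto simp: core_def)
  have Q: "covers2 ?D a b" if "a \<in> X" "b = \<sigma> a" for a b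
  proof -
    have "quads a b \<union> quads b a \<subseteq> ?D" using that \<sigma>[of a] unfolding double_def by auto
    then show ?thesis by (rule covers2_mono[OF quads_cover])
  qed
  have sq: "squares X \<sigma> \<subseteq> ?D" and li: "lifts K \<subseteq> ?D" by (auto simp: double_def)
  have "covers ?D ((x, r), (y, s), (z, t))" if e: "((x, r), (y, s), (z, t)) \<in> targets ?\<tau> ?Y" for x y z r s t
  proof -
    have X: "x \<in> X" "y \<in> X" "z \<in> X" using e by (auto simp: targets_def)
    consider "x = y" "y = z" | "x = y" "z \<noteq> x" | "y = z" "x \<noteq> y" | "x \<noteq> y" "y \<noteq> z" "x = z" "y = \<sigma> x" |
        "(x, y, z) \<in> targets \<sigma> X"
      using X by (auto simp: targets_def)
    then show ?thesis
    proof cases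
      case 1
      then show ?thesis using e by (auto simp: targets_def)
    next
      case 2
      then have "r \<noteq> s" using e by (auto simp: targets_def)
      then show ?thesis
        using Q[OF X(1)] covers_mono[OF squares_cover(1)[OF X(1,3)] sq] 2 by (cases "z = \<sigma> x") (auto simp: covers2_def)
    next
      case 3
      then have "s \<noteq> t" using e by (auto simp: targets_def)
      then show ?thesis
        using Q[OF X(1)] covers_mono[OF squares_cover(2)[OF X(1,2)] sq] 3 by (cases "y = \<sigma> x") (auto simp: covers2_def)
    next
      case 4
      then show ?thesis using Q[OF X(1) 4(4)] by (simp add: covers2_def)
    next
      case 5
      then show ?thesis using covers_mono[OF lifts_cover[OF cov] li] by simp
    qed
  qed
  then have covers: "\<forall>t\<in>targets ?\<tau> ?Y. covers ?D t" by auto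
  have "lifts K \<subseteq> ?Y \<times> ?Y \<times> ?Y \<times> ?Y" using K by (auto simp: lifts_def)
  moreover have "squares X \<sigma> \<subseteq> ?Y \<times> ?Y \<times> ?Y \<times> ?Y" by (auto simp: squares_def)
  moreover have "quads a (\<sigma> a) \<subseteq> ?Y \<times> ?Y \<times> ?Y \<times> ?Y" if "a \<in> X" for a using \<sigma>[OF that] that by (auto simp: quads_def)
  ultimately have sub: "?D \<subseteq> ?Y \<times> ?Y \<times> ?Y \<times> ?Y" unfolding double_def by blast
  have finK: "finite K" using K fin by (meson finite_SigmaI finite_subset)
  have "card (lifts K) \<le> card (K \<times> (UNIV :: (bool \<times> bool \<times> bool) set)) * 1"
    unfolding lifts_def by (rule card_UN_bounded) (use finK in \<open>auto split: prod.split\<close>)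
  then have l: "card (lifts K) \<le> 8 * card K" by (simp add: card_cartesian_product flip: UNIV_Times_UNIV)
  have "card (X - {a, \<sigma> a}) = card X - 2" if "a \<in> X" for a
    using \<sigma>[OF that] that fin by (subst card_Diff_subset) auto
  then have "card (SIGMA a:X. X - {a, \<sigma> a}) = card X * (card X - 2)" using fin by simp
  moreover have "card (squares X \<sigma>) \<le> card (SIGMA a:X. X - {a, \<sigma> a}) * 2"
    unfolding squares_def
  proof (rule card_UN_bounded)
    fix p
    show "card (case p of (a, b) \<Rightarrow> \<Union>r. {((a, r), (a, \<not> r), (b, r), (b, \<not> r))}) \<le> 2"
      using card_UN_bounded[of UNIV "\<lambda>r. {((fst p, r), (fst p, \<not> r), (snd p, r), (snd p, \<not> r))}" 1]
      by (cases p) simp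
  qed (use fin in auto)
  ultimately have s: "card (squares X \<sigma>) \<le> card X * (card X - 2) * 2" by simp
  have "card (quads a b) \<le> 4" for a b :: 'a
    unfolding quads_def by (rule order_trans, (rule card_insert_Suc)+, rule card.empty[THEN eq_imp_le], simp)
  then have q: "card (\<Union>a\<in>X. quads a (\<sigma> a)) \<le> card X * 4" using fin by (intro card_UN_bounded)
  have "card ?D \<le> card (lifts K) + card (squares X \<sigma>) + card (\<Union>a\<in>X. quads a (\<sigma> a))"
    unfolding double_def using card_Un_le le_trans add_le_mono1 by meson
  then have D: "card ?D \<le> 8 * card K + card X * (card X - 2) * 2 + card X * 4" using l s q by linarith
  have cY: "card ?Y = 2 * card X" by (simp add: card_cartesian_product)
  have "4 * card ?D + card ?Y \<le> card ?Y * (card ?Y - 1)\<^sup>2"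
  proof (cases "X = {}")
    case True
    then show ?thesis using D card by simp
  next
    case False
    then obtain x where "x \<in> X" by blast
    \<comment> \<open>There are at least two letters; writing their number as \<open>n + 2\<close>
      removes the truncated subtractions.\<close>
    then have "card {x, \<sigma> x} \<le> card X" using \<sigma>[of x] fin by (intro card_mono) auto
    then obtain n where n: "card X = n + 2" using \<sigma>[OF \<open>x \<in> X\<close>] by (auto simp: le_iff_add)
    show ?thesis using D card unfolding cY n by (simp add: power2_eq_square algebra_simps)
  qed
  then show ?thesis using fin covers sub by (auto simp: core_def)
qed

section \<open>The upper bound\<close>

definition weight :: "nat list \<Rightarrow> nat" where
  "weight t = (if t ! 0 = t ! 1 then if t ! 1 = t ! 2 then 4 else 2 else if t ! 1 = t ! 2 then 2 else 1)"

definition sandwiches :: "nat \<Rightarrow> nat list set" where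
  "sandwiches a = {[a, b, a] |b. b \<noteq> a}"

text \<open>These are the letters whose parity defect is charged to the codeword
  \<open>x\<close>.\<close>

definition odd_letters :: "nat list \<Rightarrow> nat set" where
  "odd_letters x = {a. odd (card (del1 x \<inter> sandwiches a))}"

lemma del1_four: "del1 [a, b, c, d] = {[b, c, d], [a, c, d], [a, b, d], [a, b, c]}"
proof -
  have "del1 x = (\<lambda>i. take i x @ drop (Suc i) x) ` {..<length x}" for x
    by (auto simp: del1_def)
  then show ?thesis by (simp add: lessThan_Suc numeral_eq_Suc insert_commute)
qed

lemma words_3: "words 3 q = (\<lambda>(a, b, c). [a, b, c]) ` ({0..<q} \<times> {0..<q} \<times> {0..<q})"
  by (force simp: words_def numeral_eq_Suc length_Suc_conv)

lemma words_4E: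
  assumes "x \<in> words 4 q" obtains a b c d where "x = [a, b, c, d]" "a < q" "b < q" "c < q" "d < q"
  using assms that by (auto simp: words_def numeral_eq_Suc length_Suc_conv)

lemma odd_letters_subset: "odd_letters [a, b, c, d] \<subseteq> {a, b}"
proof
  fix e assume "e \<in> odd_letters [a, b, c, d]"
  then have "del1 [a, b, c, d] \<inter> sandwiches e \<noteq> {}" by (auto simp: odd_letters_def)
  then show "e \<in> {a, b}" by (auto simp: del1_four sandwiches_def)
qed

text \<open>Only the equality pattern of the letters matters, so the check is finite. For example,
  \<open>abba\<close> yields weight 5 with odd letter \<open>a\<close>, and \<open>abab\<close>
  yields weight 6 with two odd letters.\<close>

lemma weight_del1: "4 + card (odd_letters [a, b, c, d]) \<le> (\<Sum>t\<in>del1 [a, b, c, d]. weight t)"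
proof -
  have mem: "[x, y, z] \<in> sandwiches e \<longleftrightarrow> x = e \<and> z = e \<and> y \<noteq> e" for x y z e
    by (auto simp: sandwiches_def)
  let ?O = "odd_letters [a, b, c, d]"
  have O: "e \<in> ?O \<longleftrightarrow> odd (card (del1 [a, b, c, d] \<inter> sandwiches e))" for e
    by (simp add: odd_letters_def)
  have "?O \<subseteq> (if a \<in> ?O then {a} else {}) \<union> (if b \<in> ?O \<and> b \<noteq> a then {b} else {})"
    using odd_letters_subset[of a b c d] by auto
  then have "card ?O \<le> of_bool (a \<in> ?O) + of_bool (b \<in> ?O \<and> b \<noteq> a)"
    by (rule order_trans[OF card_mono[rotated]]) auto
  moreover have "4 + (of_bool (a \<in> ?O) + of_bool (b \<in> ?O \<and> b \<noteq> a)) \<le> (\<Sum>t\<in>del1 [a, b, c, d]. weight t)"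
    unfolding O del1_four
    by (cases "a = b"; cases "a = c"; cases "a = d"; cases "b = c"; cases "b = d"; cases "c = d")
       (simp_all add: Int_insert_left mem weight_def)
  ultimately show ?thesis by linarith
qed

lemma weight_word:
  assumes "x \<in> words 4 q"
  shows "finite (odd_letters x)" "4 + card (odd_letters x) \<le> (\<Sum>t\<in>del1 x. weight t)"
  by (rule words_4E[OF assms]; simp add: finite_subset[OF odd_letters_subset] weight_del1)+

lemma weight_total: "(\<Sum>t\<in>words 3 q. weight t) = q ^ 3 + 2 * q\<^sup>2 + q"
proof -
  have "(\<Sum>t\<in>words 3 q. weight t) = (\<Sum>(a, b, c)\<in>{0..<q} \<times> {0..<q} \<times> {0..<q}. weight [a, b, c])"
    unfolding words_3 by (subst sum.reindex) (auto simp: inj_on_def intro!: sum.cong)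
  \<comment> \<open>The weight factors at the middle letter, so each \<open>b\<close> contributes
    \<open>(q + 1)^2\<close>.\<close>
  also have "\<dots> = (\<Sum>b<q. \<Sum>a<q. \<Sum>c<q. (1 + of_bool (a = b)) * (1 + of_bool (b = c)))"
    by (simp add: sum.cartesian_product[symmetric] atLeast0LessThan, subst sum.swap)
       (auto simp: weight_def intro!: sum.cong)
  also have "\<dots> = (\<Sum>b<q. (\<Sum>a<q. 1 + of_bool (a = b)) * (\<Sum>c<q. 1 + of_bool (b = c)))"
    by (simp add: sum_product)
  also have "\<dots> = (\<Sum>b<q. (q + 1) * (q + 1))"
  proof (rule sum.cong)
    fix b assume "b \<in> {..<q}"
    then have "(\<Sum>a<q. of_bool (a = b)) = (1 :: nat)" "(\<Sum>c<q. of_bool (b = c)) = (1 :: nat)"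
      by (simp_all add: of_bool_def)
    then show "(\<Sum>a<q. 1 + of_bool (a = b)) * (\<Sum>c<q. 1 + of_bool (b = c)) = (q + 1) * (q + 1)"
      by (simp only: sum.distrib) simp
  qed simp
  also have "\<dots> = q ^ 3 + 2 * q\<^sup>2 + q" by (simp add: power2_eq_square power3_eq_cube algebra_simps)
  finally show ?thesis .
qed

theorem single_deletion_code_bound:
  assumes "even q" "C \<subseteq> words 4 q" "single_deletion_code C"
  shows "4 * card C \<le> q\<^sup>2 * (q + 2)"
proof -
  let ?D = "\<Union>x\<in>C. del1 x" and ?S = "\<lambda>a. sandwiches a \<inter> words 3 q"
  have fw: "finite (words n q)" for n
    unfolding words_def using finite_lists_length_eq[of "{0..<q}" n] by (simp add: conj_commute)
  have fC: "finite C" using fw assms(2) finite_subset by blast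
  have fd: "finite (del1 x)" for x by (simp add: del1_def)
  have D: "?D \<subseteq> words 3 q"
  proof
    fix t assume "t \<in> ?D"
    then obtain x where x: "x \<in> C" "t \<in> del1 x" by blast
    with assms(2) obtain a b c d where "x = [a, b, c, d]" "a < q" "b < q" "c < q" "d < q"
      by (meson words_4E subsetD)
    then show "t \<in> words 3 q" using x by (auto simp: del1_four words_def)
  qed
  have disj: "del1 x \<inter> del1 y = {}" if "x \<in> C" "y \<in> C" "x \<noteq> y" for x y
    using assms(3) that by (auto simp: single_deletion_code_def)
  have odd: "a \<in> (\<Union>x\<in>C. odd_letters x) \<or> ?S a - ?D \<noteq> {}" if "a < q" for a
  proof (rule ccontr)
    assume neg: "\<not> ?thesis"
    have "?S a = (\<lambda>b. [a, b, a]) ` ({0..<q} - {a})"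
      using that by (auto simp: sandwiches_def words_def)
    then have "card (?S a) = q - 1" using that by (simp add: card_image inj_on_def)
    moreover have "?S a = (\<Union>x\<in>C. del1 x \<inter> sandwiches a)" using neg D by blast
    moreover have "card (\<Union>x\<in>C. del1 x \<inter> sandwiches a) = (\<Sum>x\<in>C. card (del1 x \<inter> sandwiches a))"
    proof (rule card_UN_disjoint[OF fC])
      show "\<forall>x\<in>C. finite (del1 x \<inter> sandwiches a)" using fd by simp
      show "\<forall>x\<in>C. \<forall>y\<in>C. x \<noteq> y \<longrightarrow> (del1 x \<inter> sandwiches a) \<inter> (del1 y \<inter> sandwiches a) = {}"
        using disj by blast
    qed
    moreover have "even (\<Sum>x\<in>C. card (del1 x \<inter> sandwiches a))"
      using neg by (intro dvd_sum) (auto simp: odd_letters_def)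
    ultimately show False using assms(1) that by (cases q) auto
  qed
  \<comment> \<open>Each letter is charged to a codeword or to an uncovered sandwich, which has
    weight at least 1. Its first letter identifies the letter charged, so different letters use
    different uncovered words.\<close>
  let ?U = "words 3 q - ?D" and ?hd = "\<lambda>t :: nat list. t ! 0"
  have "{0..<q} \<subseteq> (\<Union>x\<in>C. odd_letters x) \<union> ?hd ` ?U"
  proof
    fix a assume "a \<in> {0..<q}"
    then have "a \<in> (\<Union>x\<in>C. odd_letters x) \<or> ?S a - ?D \<noteq> {}" using odd by simp
    then show "a \<in> (\<Union>x\<in>C. odd_letters x) \<union> ?hd ` ?U"
    proof
      assume "?S a - ?D \<noteq> {}"
      then obtain t where t: "t \<in> ?S a" "t \<notin> ?D" by blast
      then have "a = ?hd t" by (auto simp: sandwiches_def)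
      then show ?thesis using t by blast
    qed blast
  qed
  moreover have fo: "finite (odd_letters x)" if "x \<in> C" for x
    using that assms(2) weight_word(1) by blast
  ultimately have "q \<le> card ((\<Union>x\<in>C. odd_letters x) \<union> ?hd ` ?U)"
    using card_mono[of "(\<Union>x\<in>C. odd_letters x) \<union> ?hd ` ?U" "{0..<q}"] fC fw by simp
  also have "\<dots> \<le> (\<Sum>x\<in>C. card (odd_letters x)) + card ?U"
    using card_Un_le[of "\<Union>x\<in>C. odd_letters x" "?hd ` ?U"] card_UN_le[OF fC, of odd_letters]
      card_image_le[of ?U ?hd] fw by fastforce
  also have "card ?U \<le> (\<Sum>t\<in>?U. weight t)"
    using sum_mono[of ?U "\<lambda>_. 1" weight] by (simp add: weight_def)
  finally have q: "q \<le> (\<Sum>x\<in>C. card (odd_letters x)) + (\<Sum>t\<in>?U. weight t)" by simp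
  have "4 * card C + (\<Sum>x\<in>C. card (odd_letters x)) = (\<Sum>x\<in>C. 4 + card (odd_letters x))"
    by (simp add: sum.distrib)
  also have "\<dots> \<le> (\<Sum>x\<in>C. \<Sum>t\<in>del1 x. weight t)"
    by (intro sum_mono weight_word(2)[OF subsetD[OF assms(2)]])
  also have "\<dots> = (\<Sum>t\<in>?D. weight t)"
    by (rule sum.UNION_disjoint[symmetric, OF fC]) (simp_all add: fd disj)
  finally have "4 * card C + q \<le> (\<Sum>t\<in>?D. weight t) + (\<Sum>t\<in>?U. weight t)" using q by linarith
  also have "\<dots> = q ^ 3 + 2 * q\<^sup>2 + q"
    using sum.subset_diff[OF D fw, of weight] weight_total by simp
  finally show ?thesis by (simp add: power2_eq_square power3_eq_cube algebra_simps)
qed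

section \<open>From covers to perfect codes\<close>

text \<open>The union has size at least \<open>card T\<close> and at most \<open>c * card K\<close>,
  hence equality holds throughout and no overlap can be afforded.\<close>

lemma exact_cover:
  assumes "finite K" "\<And>w. w \<in> K \<Longrightarrow> finite (f w) \<and> card (f w) \<le> c" "T \<subseteq> (\<Union>w\<in>K. f w)" "c * card K \<le> card T"
  shows "(\<Union>w\<in>K. f w) = T" "c * card K = card T" "v \<in> K \<Longrightarrow> w \<in> K \<Longrightarrow> v \<noteq> w \<Longrightarrow> f v \<inter> f w = {}"
proof -
  have fin: "finite (\<Union>w\<in>K. f w)" using assms by blast
  have bound: "card (\<Union>w\<in>K. f w) \<le> card K * c" using assms by (intro card_UN_bounded) auto
  have T: "card T \<le> card (\<Union>w\<in>K. f w)" using assms(3) fin by (rule card_mono[rotated])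
  then show "(\<Union>w\<in>K. f w) = T" using bound assms(3,4) fin by (metis card_subset_eq le_antisym le_trans mult.commute)
  show "c * card K = card T" using T bound assms(4) by (simp add: mult.commute)
  assume vw: "v \<in> K" "w \<in> K" "v \<noteq> w"
  show "f v \<inter> f w = {}"
  proof (rule ccontr)
    assume "f v \<inter> f w \<noteq> {}"
    then obtain t where t: "t \<in> f v" "t \<in> f w" by blast
    \<comment> \<open>A common element \<open>t\<close> may be removed from \<open>f v\<close>
      without changing the union, which makes the count too small.\<close>
    have "(\<Union>w\<in>K. f w) \<subseteq> (\<Union>w\<in>K - {v}. f w) \<union> (f v - {t})" using vw t by blast
    then have "card (\<Union>w\<in>K. f w) \<le> card ((\<Union>w\<in>K - {v}. f w) \<union> (f v - {t}))"
      using assms(1,2) vw by (intro card_mono) auto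
    also have "\<dots> \<le> card (\<Union>w\<in>K - {v}. f w) + card (f v - {t})" by (rule card_Un_le)
    also have "\<dots> \<le> card (K - {v}) * c + card (f v - {t})"
      using assms(1,2) by (intro add_right_mono card_UN_bounded) auto
    also have "card (f v - {t}) < c"
      using card_Diff1_less[of "f v" t] assms(2)[OF vw(1)] t by simp
    finally have "card (\<Union>w\<in>K. f w) < (card (K - {v}) + 1) * c" by simp
    moreover have "card (K - {v}) + 1 = card K" using assms(1) vw by (metis Suc_eq_plus1 card_Suc_Diff1)
    ultimately have "card (\<Union>w\<in>K. f w) < card K * c" by (simp only:)
    then show False using T assms(4) by (simp add: mult.commute)
  qed
qed

lemma card_targets:
  assumes "finite X" "\<And>x. x \<in> X \<Longrightarrow> \<sigma> x \<in> X \<and> \<sigma> x \<noteq> x"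
  shows "card (targets \<sigma> X) + card X = card X * (card X - 1)\<^sup>2"
proof -
  \<comment> \<open>The middle letter is chosen first, then its two neighbours independently;
    \<open>?B\<close> holds the omitted sandwiches.\<close>
  let ?A = "SIGMA y:X. (X - {y}) \<times> (X - {y})" and ?f = "\<lambda>(y, x, z). (x, y, z)"
  let ?B = "(\<lambda>x. (x, \<sigma> x, x)) ` X"
  have "card (?f ` ?A) = card ?A" by (rule card_image) (auto simp: inj_on_def)
  also have "\<dots> = (\<Sum>y\<in>X. (card X - 1)\<^sup>2)"
    using assms(1) by (subst card_SigmaI) (auto simp: card_cartesian_product power2_eq_square)
  finally have A: "card (?f ` ?A) = card X * (card X - 1)\<^sup>2" by simp
  have "targets \<sigma> X = ?f ` ?A - ?B" by (auto simp: targets_def image_iff)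
  moreover have "?B \<subseteq> ?f ` ?A" using assms(2) by (force simp: image_iff)
  moreover have "card ?B = card X" by (rule card_image) (auto simp: inj_on_def)
  ultimately have "card (targets \<sigma> X) = card (?f ` ?A) - card X" "card X \<le> card (?f ` ?A)"
    using assms(1) card_Diff_subset[of ?B "?f ` ?A"] card_mono[of "?f ` ?A" ?B] by simp_all
  then show ?thesis using A by simp
qed

text \<open>Renaming the letters returns to natural numbers, so that doubling can be iterated within
  one type.\<close>

lemma core_transfer:
  assumes "core X \<sigma> K"
  shows "\<exists>\<tau> L. core {0..<card X} \<tau> L"
proof -
  have fin: "finite X" and K: "K \<subseteq> X \<times> X \<times> X \<times> X"
    and \<sigma>: "\<And>x. x \<in> X \<Longrightarrow> \<sigma> x \<in> X \<and> \<sigma> x \<noteq> x \<and> \<sigma> (\<sigma> x) = x"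
    and cov: "\<And>t. t \<in> targets \<sigma> X \<Longrightarrow> covers K t"
    and card: "4 * card K + card X \<le> card X * (card X - 1)\<^sup>2"
    using assms by (auto simp: core_def)
  obtain f where f: "bij_betw f X {0..<card X}" using ex_bij_betw_finite_nat[OF fin] by blast
  define g where "g = inv_into X f"
  have fg: "f (g n) = n" "g n \<in> X" if "n \<in> {0..<card X}" for n
    using that f unfolding g_def by (auto simp: bij_betw_def f_inv_into_f inv_into_into)
  have gf: "g (f x) = x" "f x \<in> {0..<card X}" if "x \<in> X" for x
    using that f unfolding g_def by (auto simp: bij_betw_def inv_into_f_f)
  let ?m = "\<lambda>(a, b, c, d). (f a, f b, f c, f d)" and ?\<tau> = "\<lambda>n. f (\<sigma> (g n))"
  have "covers (?m ` K) (x, y, z)" if t: "(x, y, z) \<in> targets ?\<tau> {0..<card X}" for x y z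
  proof -
    have r: "x \<in> {0..<card X}" "y \<in> {0..<card X}" "z \<in> {0..<card X}" using t by (auto simp: targets_def)
    have "(g x, g y, g z) \<in> targets \<sigma> X"
      using t fg r unfolding targets_def by (auto, metis+)
    then obtain a b c d where w: "(a, b, c, d) \<in> K" "(g x, g y, g z) \<in> del4 (a, b, c, d)"
      using cov by (fastforce simp: covers_def)
    then have "(f (g x), f (g y), f (g z)) \<in> del4 (?m (a, b, c, d))" by auto
    then show ?thesis using w(1) fg r unfolding covers_def by (metis (no_types, lifting) imageI)
  qed
  then have "\<forall>t\<in>targets ?\<tau> {0..<card X}. covers (?m ` K) t" by auto
  moreover have "?m ` K \<subseteq> {0..<card X} \<times> {0..<card X} \<times> {0..<card X} \<times> {0..<card X}"
    using K gf by (fastforce simp: image_iff)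
  moreover have "card (?m ` K) \<le> card K"
    using K fin by (intro card_image_le) (meson finite_SigmaI finite_subset)
  moreover have "\<forall>n\<in>{0..<card X}. ?\<tau> n \<in> {0..<card X} \<and> ?\<tau> n \<noteq> n \<and> ?\<tau> (?\<tau> n) = n"
    using fg gf \<sigma> by metis
  ultimately have "core {0..<card X} ?\<tau> (?m ` K)"
    using card unfolding core_def by (intro conjI) auto
  then show ?thesis by blast
qed

lemma odd_core_exists:
  assumes "odd k" shows "\<exists>\<sigma> K. core {0..<6 * k} \<sigma> (K :: nat quad set)"
proof -
  obtain j where j: "k = 2 * j + 1" using assms by (elim oddE)
  \<comment> \<open>For \<open>k = 2 * j + 1\<close> the modulus is
    \<open>3 * k = 2 * (3 * j + 1) + 1\<close>.\<close>
  interpret odd_base "3 * j + 1" "int k" "int (3 * k)" by unfold_locales (simp_all add: j)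
  have "card ({0..<int (3 * k)} \<times> (UNIV :: bool set)) = 6 * k" by (simp add: card_cartesian_product)
  then show ?thesis using core_transfer[OF core_base_core] by simp
qed

lemma core_exists:
  assumes "m \<ge> 1" shows "\<exists>\<sigma> K. core {0..<6 * m} \<sigma> (K :: nat quad set)"
  using assms
proof (induction m rule: less_induct)
  case (less m)
  show ?case
  proof (cases "even m")
    case True
    then obtain n where m: "m = 2 * n" by blast
    with less obtain \<sigma> and K :: "nat quad set" where "core {0..<6 * n} \<sigma> K" by force
    from core_transfer[OF core_double[OF this]] show ?thesis by (simp add: m card_cartesian_product)
  qed (rule odd_core_exists)
qed

text \<open>The added words, with \<open>x = y\<close> allowed, account for all triples having two
  equal adjacent letters.\<close>

definition code_of :: "nat \<Rightarrow> nat quad set \<Rightarrow> nat list set" where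
  "code_of q K = (\<lambda>(a, b, c, d). [a, b, c, d]) ` K \<union> (\<lambda>(x, y). [x, x, y, y]) ` ({0..<q} \<times> {0..<q})"

lemma del1_quad: "del1 [a, b, c, d] = (\<lambda>(x, y, z). [x, y, z]) ` del4 (a, b, c, d)"
  by (simp add: del1_four)

lemma perfect_code:
  assumes "core {0..<q} \<sigma> K"
  shows "code_of q K \<subseteq> words 4 q" "single_deletion_code (code_of q K)"
    "4 * card (code_of q K) = q\<^sup>2 * (q + 2)"
proof -
  let ?X = "{0..<q}" and ?w = "\<lambda>(a, b, c, d). [a, b, c, d :: nat]" and ?s = "\<lambda>(x, y). [x, x, y, y :: nat]"
  have K: "K \<subseteq> ?X \<times> ?X \<times> ?X \<times> ?X"
    and \<sigma>: "\<And>x. x \<in> ?X \<Longrightarrow> \<sigma> x \<in> ?X \<and> \<sigma> x \<noteq> x"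
    and cov: "targets \<sigma> ?X \<subseteq> (\<Union>w\<in>K. del4 w)"
    and card: "4 * card K + q \<le> q * (q - 1)\<^sup>2"
    using assms by (auto simp: core_def covers_def)
  have fin: "finite K" using K by (rule finite_subset) simp
  have targets: "card (targets \<sigma> ?X) + q = q * (q - 1)\<^sup>2" using card_targets[of ?X \<sigma>] \<sigma> by simp
  have del4: "finite (del4 w) \<and> card (del4 w) \<le> 4" for w :: "nat quad"
  proof (cases w)
    case (fields a b c d)
    show ?thesis using card_length[of "[(b, c, d), (a, c, d), (a, b, d), (a, b, c)]"] by (simp add: fields)
  qed
  have "4 * card K \<le> card (targets \<sigma> ?X)" using card targets by linarith
  note exact = exact_cover[of K del4 4, OF fin del4 cov this]
  have del1: "del1 (?w w) = (\<lambda>(x, y, z). [x, y, z]) ` del4 w" for w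
    by (cases w) (simp add: del1_quad)
  \<comment> \<open>By exactness the words of \<open>K\<close> yield targets only, whereas every
    deletion of \<open>xxyy\<close> has equal neighbours.\<close>
  have adjacent: "\<not> (\<exists>x y. t = [x, x, y] \<or> t = [x, y, y])" if "w \<in> K" "t \<in> del1 (?w w)" for w t
  proof -
    obtain x y z where t: "t = [x, y, z]" "(x, y, z) \<in> del4 w" using \<open>t \<in> del1 (?w w)\<close> unfolding del1 by auto
    then have "(x, y, z) \<in> targets \<sigma> ?X" using exact(1) \<open>w \<in> K\<close> by blast
    then show ?thesis by (auto simp: t(1) targets_def)
  qed
  have dK: "del1 (?w v) \<inter> del1 (?w w) = {}" if "v \<in> K" "w \<in> K" "v \<noteq> w" for v w
    using exact(3)[OF that] unfolding del1 by auto
  have inj: "inj_on ?w K" by (auto simp: inj_on_def)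
  have sq: "\<exists>x y. t = [x, x, y] \<or> t = [x, y, y]" if "t \<in> del1 (?s p)" for t p
    using that by (cases p) (auto simp: del1_four)
  have sK: "del1 (?w w) \<inter> del1 (?s p) = {}" if "w \<in> K" for w p
    using adjacent[OF that] sq by blast
  \<comment> \<open>Each deletion of \<open>xxyy\<close> still begins with \<open>x\<close> and ends
    with \<open>y\<close>.\<close>
  have ss: "p = p'" if "del1 (?s p) \<inter> del1 (?s p') \<noteq> {}" for p p'
    using that by (cases p; cases p') (auto simp: del1_four)
  show "code_of q K \<subseteq> words 4 q" using K by (auto simp: code_of_def words_def)
  show "single_deletion_code (code_of q K)"
    unfolding single_deletion_code_def
  proof (intro ballI impI)
    fix x y assume "x \<in> code_of q K" "y \<in> code_of q K" "x \<noteq> y"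
    then consider v w where "v \<in> K" "w \<in> K" "v \<noteq> w" "x = ?w v" "y = ?w w" |
        v p where "v \<in> K" "x = ?w v" "y = ?s p" | w p where "w \<in> K" "y = ?w w" "x = ?s p" |
        p p' where "x = ?s p" "y = ?s p'" "p \<noteq> p'"
      unfolding code_of_def by blast
    then show "del1 x \<inter> del1 y = {}"
    proof cases
      case 1
      then show ?thesis using dK by simp
    next
      case 2
      then show ?thesis using sK by simp
    next
      case 3
      then show ?thesis using sK by (simp add: Int_commute)
    next
      case 4
      then show ?thesis using ss by blast
    qed
  qed
  have "?w ` K \<inter> ?s ` (?X \<times> ?X) = {}"
  proof (rule ccontr)
    assume "?w ` K \<inter> ?s ` (?X \<times> ?X) \<noteq> {}"
    then obtain w p where "w \<in> K" "?w w = ?s p" by blast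
    then have "del1 (?s p) = {}" using sK[of w p] by simp
    then show False by (cases p) (simp add: del1_four)
  qed
  moreover have "card (?w ` K) = card K" using inj by (rule card_image)
  moreover have "card (?s ` (?X \<times> ?X)) = q * q"
    by (subst card_image) (auto simp: inj_on_def card_cartesian_product)
  ultimately have "card (code_of q K) = card K + q * q"
    unfolding code_of_def using fin by (subst card_Un_disjoint) auto
  \<comment> \<open>The right side is \<open>q * (q + 1)^2\<close>, the total weight in the upper
    bound.\<close>
  then have "4 * card (code_of q K) + q = q * (q - 1)\<^sup>2 + 4 * (q * q)" using exact(2) targets by simp
  then show "4 * card (code_of q K) = q\<^sup>2 * (q + 2)"
    by (cases q) (simp_all add: power2_eq_square algebra_simps)
qed

theorem theorem4p3:
  fixes m :: nat
  assumes "m \<ge> 1"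
  defines "q \<equiv> 6 * m"
  shows "\<exists>C. C \<subseteq> words 4 q \<and> single_deletion_code C \<and>
             card C = N1 4 q \<and> 4 * N1 4 q = q^2 * (q + 2)"
proof -
  obtain \<sigma> K where "core {0..<q} \<sigma> K" using core_exists[OF assms(1)] unfolding q_def by blast
  note C = perfect_code[OF this]
  let ?C = "code_of q K" and ?S = "{card C |C. C \<subseteq> words 4 q \<and> single_deletion_code C}"
  have "even q" by (simp add: q_def)
  have "n \<le> card ?C" if n: "n \<in> ?S" for n
  proof -
    obtain D where "n = card D" "D \<subseteq> words 4 q" "single_deletion_code D" using n by blast
    then show ?thesis using single_deletion_code_bound[OF \<open>even q\<close>, of D] C(3) by simp
  qed
  moreover have "card ?C \<in> ?S" using C(1,2) by blast
  ultimately have "N1 4 q = card ?C"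
    unfolding N1_def by (intro Max_eqI) (auto intro: finite_subset[of ?S "{..card ?C}"])
  then show ?thesis using C by metis
qed

end
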